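(* For $n\ge1$ let $d_{n,4}(q):=\sum_{w\in\mathcal F_{n,2}}q^{\deg_4(G(w))}$. Then for all $n\ge3$, $$d_{n,4}(q)=d_{n-1,4}(q)+q^2d_{n-2,4}(q),$$ with $d_{1,4}(q)=2$ and $d_{2,4}(q)=1+2q$. Moreover, for all $n\ge1$, $$d_{n,4}(q)=\sum_{i=0}^{n+2}\left(\binom{n-1-\lfloor (i-2)/2\rfloor}{\lfloor (i-3)/2\rfloor}+\binom{n-2-\lfloor (i-3)/2\rfloor}{\lfloor (i-4)/2\rfloor}\right)q^{i-3}.$$
   Context: $\mathcal F_{n,2}$ is the set of binary words $w=w_1\cdots w_n$ with no two consecutive $1$'s. $P(w)$ is the bargraph polyomino formed by the unit squares $[i-1,i]\times[j-1,j]$, $1\le i\le n$, $1\le j\le w_i+1$. $G(w)$ is the graph whose vertices are the corners of the cells of $P(w)$ and whose edges are the cell sides. $\deg_4(G)$ is the number of vertices of degree $4$ in $G$. Binomial coefficients with integer arguments follow the convention $\binom{a}{a}=1$ for every integer $a$ (in particular $\binom{-1}{-1}=1$), $\binom{a}{b}=0$ if $b>a$, and $\binom{a}{b}=0$ if $b<0$ and $b\ne a$. *)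

theory Defs
  imports Complex_Main "HOL-Computational_Algebra.Computational_Algebra"
begin

definition fib_words :: "nat \<Rightarrow> nat list set" where
  "fib_words n = {w. length w = n \<and> set w \<subseteq> {0, 1} \<and>
     (\<forall>i. Suc i < n \<longrightarrow> \<not> (w ! i = 1 \<and> w ! Suc i = 1))}"

text \<open>The pair \<open>(i, j)\<close> with \<open>i, j \<ge> 1\<close> stands for the unit square
  \<open>[i-1, i] \<times> [j-1, j]\<close>. The letter \<open>w\<^sub>i\<close> is \<open>w ! (i - 1)\<close>, as lists are indexed from 0.\<close>

definition bargraph_cells :: "nat list \<Rightarrow> (nat \<times> nat) set" where
  "bargraph_cells w = {(i, j). 1 \<le> i \<and> i \<le> length w \<and> 1 \<le> j \<and> j \<le> w ! (i - 1) + 1}"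

fun cell_corners :: "nat \<times> nat \<Rightarrow> (nat \<times> nat) set" where
  "cell_corners (i, j) = {(i - 1, j - 1), (i, j - 1), (i - 1, j), (i, j)}"

fun cell_sides :: "nat \<times> nat \<Rightarrow> (nat \<times> nat) set set" where
  "cell_sides (i, j) =
     {{(i - 1, j - 1), (i, j - 1)}, {(i - 1, j), (i, j)},
      {(i - 1, j - 1), (i - 1, j)}, {(i, j - 1), (i, j)}}"

type_synonym 'v ugraph = "'v set \<times> 'v set set"

definition bargraph_graph :: "nat list \<Rightarrow> (nat \<times> nat) ugraph" where
  "bargraph_graph w =
     (\<Union>c\<in>bargraph_cells w. cell_corners c, \<Union>c\<in>bargraph_cells w. cell_sides c)"

definition vertex_degree :: "'v ugraph \<Rightarrow> 'v \<Rightarrow> nat" where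
  "vertex_degree G v = card {e \<in> snd G. v \<in> e}"

definition deg4 :: "'v ugraph \<Rightarrow> nat" where
  "deg4 G = card {v \<in> fst G. vertex_degree G v = 4}"

definition d4 :: "nat \<Rightarrow> int poly" where
  "d4 n = (\<Sum>w\<in>fib_words n. monom 1 (deg4 (bargraph_graph w)))"

text \<open>This differs from \<open>gchoose\<close> at negative upper arguments; in particular
  \<open>int_binom (- 1) (- 1) = 1\<close>, and \<open>int_binom a b = 0\<close> whenever \<open>a < b\<close>, even for \<open>a < 0 \<le> b\<close>.\<close>

definition int_binom :: "int \<Rightarrow> int \<Rightarrow> int" where
  "int_binom a b =
     (if b = a then 1
      else if b > a then 0
      else if b < 0 then 0
      else int (nat a choose nat b))"

text \<open>Embedding of polynomials into Laurent series, where \<open>q ^ (i - 3)\<close> with \<open>i < 3\<close>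
  is meaningful.\<close>

definition fls_of_poly :: "int poly \<Rightarrow> int fls" where
  "fls_of_poly p = fps_to_fls (fps_of_poly p)"

end

theory Submission
  imports Defs
begin

text \<open>A vertex of \<open>G(w)\<close> has degree 4 iff it lies on the line \<open>y = 1\<close>, strictly between two columns
  at least one of which has height 2. Hence the statistic is the number of adjacent pairs of
  letters of \<open>w\<close> containing a \<open>1\<close>. Splitting words as \<open>0 w\<close> or \<open>1 0 w\<close> and
  writing \<open>Z n\<close> for the sum over the words \<open>0 w\<close> with \<open>w\<close> of length \<open>n\<close>, one gets
  \<open>d (n + 2) = Z (n + 1) + q Z n\<close> and \<open>Z (n + 2) = Z (n + 1) + q\<^sup>2 Z n\<close>, so \<open>d\<close> inherits the
  recurrence of \<open>Z\<close>. The coefficients in the closed formula obey the same recurrence by Pascal's rule,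
  where the convention \<open>binom (-1) (-1) = 1\<close> is what makes the boundary cases come out right.\<close>

section \<open>Vertices of degree 4\<close>

text \<open>Neighbouring cells share sides; naming each edge by its left or lower endpoint turns
  membership into inequalities. A vertical side may bound a column on its right or on its left,
  hence the two choices for \<open>x\<close>.\<close>

lemma bargraph_edges:
  "snd (bargraph_graph w) =
     {{(x, y), (Suc x, y)} | x y. x < length w \<and> y \<le> Suc (w ! x)} \<union>
     {{(x, y), (x, Suc y)} | x y. (\<exists>k < length w. (x = k \<or> x = Suc k) \<and> y \<le> w ! k)}"
  (is "_ = ?H \<union> ?V")
proof (intro subset_antisym subsetI)
  fix e assume "e \<in> snd (bargraph_graph w)"
  then obtain i j where ij: "(i, j) \<in> bargraph_cells w" and e: "e \<in> cell_sides (i, j)"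
    by (auto simp: bargraph_graph_def)
  obtain a b where ab: "i = Suc a" "j = Suc b"
    using ij by (cases i; cases j) (auto simp: bargraph_cells_def)
  have lt: "a < length w" "b \<le> w ! a"
    using ij ab by (auto simp: bargraph_cells_def)
  have "e = {(a, b), (Suc a, b)} \<or> e = {(a, Suc b), (Suc a, Suc b)}
      \<or> e = {(a, b), (a, Suc b)} \<or> e = {(Suc a, b), (Suc a, Suc b)}"
    using e ab by simp
  then show "e \<in> ?H \<union> ?V"
  proof (elim disjE)
    assume "e = {(a, b), (Suc a, b)}"
    moreover have "b \<le> Suc (w ! a)" using lt by simp
    ultimately have "e \<in> ?H" using lt by blast
    then show ?thesis by blast
  next
    assume "e = {(a, Suc b), (Suc a, Suc b)}"
    moreover have "Suc b \<le> Suc (w ! a)" using lt by simp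
    ultimately have "e \<in> ?H" using lt by blast
    then show ?thesis by blast
  next
    assume "e = {(a, b), (a, Suc b)}"
    then have "e \<in> ?V" using lt by blast
    then show ?thesis by blast
  next
    assume "e = {(Suc a, b), (Suc a, Suc b)}"
    then have "e \<in> ?V" using lt by blast
    then show ?thesis by blast
  qed
next
  have side: "e \<in> snd (bargraph_graph w)"
    if "e \<in> cell_sides (Suc k, Suc b)" "k < length w" "b \<le> w ! k" for e k b
  proof -
    have "(Suc k, Suc b) \<in> bargraph_cells w"
      using that by (simp add: bargraph_cells_def)
    then show ?thesis
      using that(1) unfolding bargraph_graph_def snd_conv by blast
  qed
  fix e assume "e \<in> ?H \<union> ?V"
  then show "e \<in> snd (bargraph_graph w)"
  proof
    assume "e \<in> ?H"
    then obtain x y where e: "e = {(x, y), (Suc x, y)}" "x < length w" "y \<le> Suc (w ! x)"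
      by blast
    show ?thesis
    \<comment> \<open>A side at positive height is the top of a cell; only at height 0 must the
      bottom of a cell be used.\<close>
    proof (cases y)
      case 0
      then show ?thesis using side[of e x 0] e by simp
    next
      case (Suc b)
      then show ?thesis using side[of e x b] e by simp
    qed
  next
    assume "e \<in> ?V"
    then obtain x y k where "e = {(x, y), (x, Suc y)}" "k < length w" "x = k \<or> x = Suc k" "y \<le> w ! k"
      by blast
    then show ?thesis using side[of e k y] by auto
  qed
qed

lemma horizontal_edge_iff:
  "{(x, y), (Suc x, y)} \<in> snd (bargraph_graph w) \<longleftrightarrow> x < length w \<and> y \<le> Suc (w ! x)"
  unfolding bargraph_edges by (auto simp: doubleton_eq_iff)

lemma vertical_edge_iff:
  "{(x, y), (x, Suc y)} \<in> snd (bargraph_graph w) \<longleftrightarrow>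
     (\<exists>k < length w. (x = k \<or> x = Suc k) \<and> y \<le> w ! k)"
  unfolding bargraph_edges by (auto simp: doubleton_eq_iff)

lemma incident_edge_cases:
  assumes "e \<in> snd (bargraph_graph w)" "(x, y) \<in> e"
  shows "e = {(x, y), (Suc x, y)} \<or> e = {(x, y), (x, Suc y)} \<or>
     (\<exists>x'. x = Suc x' \<and> e = {(x', y), (Suc x', y)}) \<or>
     (\<exists>y'. y = Suc y' \<and> e = {(x, y'), (x, Suc y')})"
  using assms unfolding bargraph_edges by auto

lemma card_three_le: "card {a, b, c} \<le> 3"
  by (auto simp: card_insert_if)

lemma vertex_degree_boundary:
  assumes "x = 0 \<or> y = 0"
  shows "vertex_degree (bargraph_graph w) (x, y) \<le> 3"
proof -
  let ?S = "{e \<in> snd (bargraph_graph w). (x, y) \<in> e}"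
  \<comment> \<open>On an axis a direction is missing: the third candidate is the downward edge if
    \<open>x = 0\<close> and the left edge otherwise. At the origin truncated subtraction yields a
    spurious singleton, harmless for an upper bound.\<close>
  have "?S \<subseteq> {{(x, y), (Suc x, y)}, {(x, y), (x, Suc y)},
      if x = 0 then {(x, y - 1), (x, y)} else {(x - 1, y), (x, y)}}" (is "_ \<subseteq> {?a, ?b, ?c}")
  proof
    fix e assume "e \<in> ?S"
    then have "e \<in> snd (bargraph_graph w)" "(x, y) \<in> e" by simp_all
    from incident_edge_cases[OF this] assms show "e \<in> {?a, ?b, ?c}" by auto
  qed
  then have "card ?S \<le> card {?a, ?b, ?c}" by (intro card_mono) simp_all
  then show ?thesis
    using card_three_le[of ?a ?b ?c] unfolding vertex_degree_def by linarith
qed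

lemma vertex_degree_Suc_eq_4_iff:
  "vertex_degree (bargraph_graph w) (Suc x, Suc y) = 4 \<longleftrightarrow>
     Suc x < length w \<and> y \<le> w ! x \<and> y \<le> w ! Suc x \<and> (Suc y \<le> w ! x \<or> Suc y \<le> w ! Suc x)"
proof -
  let ?E = "snd (bargraph_graph w)"
  let ?S = "{e \<in> ?E. (Suc x, Suc y) \<in> e}"
  let ?N = "{{(x, Suc y), (Suc x, Suc y)}, {(Suc x, Suc y), (Suc (Suc x), Suc y)},
             {(Suc x, y), (Suc x, Suc y)}, {(Suc x, Suc y), (Suc x, Suc (Suc y))}}"
  have sub: "?S \<subseteq> ?N"
  proof
    fix e assume "e \<in> ?S"
    then have "e \<in> ?E" "(Suc x, Suc y) \<in> e" by simp_all
    from incident_edge_cases[OF this] show "e \<in> ?N" by auto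
  qed
  have card: "card ?N = 4"
    by (simp add: card_insert_if doubleton_eq_iff)
  have "card ?S = 4 \<longleftrightarrow> ?S = ?N"
  proof
    assume "card ?S = 4"
    then show "?S = ?N"
      by (intro card_subset_eq sub) (simp_all only: card finite.intros)
  qed (simp only: card)
  also have "\<dots> \<longleftrightarrow> ?N \<subseteq> ?S"
    using sub by (simp only: set_eq_subset simp_thms)
  also have "\<dots> \<longleftrightarrow> ?N \<subseteq> ?E"
    by simp
  \<comment> \<open>The two horizontal edges give the bounds on \<open>y\<close> and already force
    the downward edge; the upward edge needs one of the two columns to reach higher, hence the
    disjunction.\<close>
  also have "\<dots> \<longleftrightarrow> Suc x < length w \<and> y \<le> w ! x \<and> y \<le> w ! Suc x
      \<and> (Suc y \<le> w ! x \<or> Suc y \<le> w ! Suc x)"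
    by (simp add: horizontal_edge_iff vertical_edge_iff) (auto dest: Suc_lessD)
  finally show ?thesis
    by (simp add: vertex_degree_def)
qed

text \<open>The recursive form makes the effect of prepending a letter a single summand, as the
  splitting of words requires.\<close>

fun ones_pairs :: "nat list \<Rightarrow> nat" where
  "ones_pairs (x # y # w) = of_bool (x = 1 \<or> y = 1) + ones_pairs (y # w)"
| "ones_pairs _ = 0"

lemma ones_pairs_eq_card:
  "ones_pairs w = card {i. Suc i < length w \<and> (w ! i = 1 \<or> w ! Suc i = 1)}"
proof (induction w rule: ones_pairs.induct)
  case (1 x y w)
  let ?P = "\<lambda>v i. Suc i < length v \<and> (v ! i = 1 \<or> v ! Suc i = 1)"
  have "{i. ?P (x # y # w) i} =
      (if x = 1 \<or> y = 1 then {0} else {}) \<union> Suc ` {i. ?P (y # w) i}"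
    (is "?L = ?A \<union> ?B")
  proof (intro set_eqI)
    fix i show "i \<in> ?L \<longleftrightarrow> i \<in> ?A \<union> ?B"
      by (cases i) auto
  qed
  moreover have "finite {i. ?P (y # w) i}"
    by (rule finite_subset[of _ "{..<length (y # w)}"]) auto
  ultimately show ?case
    using 1 by (simp add: card_Un_disjoint card_image)
qed simp_all

text \<open>Letters are at most 1, so a neighbouring column higher than \<open>b\<close> forces
  \<open>b = 0\<close>; the pair at \<open>i\<close>, \<open>i + 1\<close> then corresponds to the
  vertex \<open>(i + 1, 1)\<close>.\<close>

lemma deg4_bargraph:
  assumes "set w \<subseteq> {0, 1}"
  shows "deg4 (bargraph_graph w) = ones_pairs w"
proof -
  have le1: "w ! i \<le> 1" if "i < length w" for i
    using assms nth_mem[OF that] by auto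
  let ?I = "{i. Suc i < length w \<and> (w ! i = 1 \<or> w ! Suc i = 1)}"
  let ?D = "{v \<in> fst (bargraph_graph w). vertex_degree (bargraph_graph w) v = 4}"
  have "?D = (\<lambda>i. (Suc i, Suc 0)) ` ?I"
  proof (intro subset_antisym subsetI)
    fix v assume v: "v \<in> ?D"
    obtain x y where xy: "v = (x, y)" by (cases v)
    have "\<not> (x = 0 \<or> y = 0)"
    proof
      assume "x = 0 \<or> y = 0"
      from vertex_degree_boundary[OF this, of w] show False using v xy by simp
    qed
    then obtain a b where ab: "v = (Suc a, Suc b)"
      using xy by (auto simp: gr0_conv_Suc)
    with v have deg: "Suc a < length w" "b \<le> w ! a" "b \<le> w ! Suc a"
        "Suc b \<le> w ! a \<or> Suc b \<le> w ! Suc a"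
      by (auto simp: vertex_degree_Suc_eq_4_iff)
    moreover have "w ! a \<le> 1" "w ! Suc a \<le> 1"
      using le1 deg(1) by simp_all
    ultimately have "b = 0" "a \<in> ?I" by auto
    then show "v \<in> (\<lambda>i. (Suc i, Suc 0)) ` ?I" using ab by simp
  next
    fix v assume "v \<in> (\<lambda>i. (Suc i, Suc 0)) ` ?I"
    then obtain i where v: "v = (Suc i, Suc 0)" and i: "i \<in> ?I" by blast
    have "(Suc i, Suc 0) \<in> bargraph_cells w" using i by (auto simp: bargraph_cells_def)
    moreover have "v \<in> cell_corners (Suc i, Suc 0)" using v by simp
    ultimately have "v \<in> fst (bargraph_graph w)"
      unfolding bargraph_graph_def fst_conv by blast
    then show "v \<in> ?D"
      using i v by (auto simp: vertex_degree_Suc_eq_4_iff)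
  qed
  moreover have "inj_on (\<lambda>i. (Suc i, Suc 0)) ?I" by (simp add: inj_on_def)
  ultimately show ?thesis
    by (simp add: deg4_def card_image ones_pairs_eq_card)
qed

section \<open>The recurrence\<close>

lemma fib_words_0: "fib_words 0 = {[]}"
  by (auto simp: fib_words_def)

lemma fib_words_1: "fib_words (Suc 0) = {[0], [1]}"
  by (auto simp: fib_words_def length_Suc_conv)

lemma finite_fib_words: "finite (fib_words n)"
proof (rule finite_subset)
  show "fib_words n \<subseteq> {w. set w \<subseteq> {0, 1} \<and> length w = n}"
    by (auto simp: fib_words_def)
qed (simp add: finite_lists_length_eq)

lemma Cons_in_fib_words_iff:
  "x # y # w \<in> fib_words (Suc (Suc n)) \<longleftrightarrow>
     (x = 0 \<or> x = 1 \<and> y = 0) \<and> y # w \<in> fib_words (Suc n)"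
proof -
  have "(\<forall>i. Suc i < Suc (Suc n) \<longrightarrow> \<not> ((x # y # w) ! i = 1 \<and> (x # y # w) ! Suc i = 1)) \<longleftrightarrow>
    \<not> (x = 1 \<and> y = 1) \<and> (\<forall>i. Suc i < Suc n \<longrightarrow> \<not> ((y # w) ! i = 1 \<and> (y # w) ! Suc i = 1))"
    by (auto simp: nth_Cons' all_conj_distrib)
  then show ?thesis
    unfolding fib_words_def by auto
qed

lemma zero_Cons_in_fib_words_iff: "0 # w \<in> fib_words (Suc n) \<longleftrightarrow> w \<in> fib_words n"
proof (cases n)
  case 0
  then show ?thesis by (auto simp: fib_words_0 fib_words_1)
next
  case (Suc m)
  then show ?thesis
  proof (cases w)
    case Nil
    then show ?thesis using Suc by (simp add: fib_words_def)
  next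
    case (Cons y v)
    then show ?thesis using Suc by (simp add: Cons_in_fib_words_iff)
  qed
qed

text \<open>A leading 1 must be followed by 0, since length at least 2 guarantees a second
  letter.\<close>

lemma fib_words_Suc_Suc:
  "fib_words (Suc (Suc n)) = (#) 0 ` fib_words (Suc n) \<union> (\<lambda>w. 1 # 0 # w) ` fib_words n"
proof (intro set_eqI)
  fix v
  show "v \<in> fib_words (Suc (Suc n)) \<longleftrightarrow>
      v \<in> (#) 0 ` fib_words (Suc n) \<union> (\<lambda>w. 1 # 0 # w) ` fib_words n"
  proof (cases "length v = Suc (Suc n)")
    case True
    then obtain x y w where "v = x # y # w"
      by (auto simp: length_Suc_conv)
    then show ?thesis
      by (auto simp: Cons_in_fib_words_iff zero_Cons_in_fib_words_iff)
  next
    case False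
    then show ?thesis by (auto simp: fib_words_def)
  qed
qed

lemma sum_fib_words_Suc_Suc:
  "sum f (fib_words (Suc (Suc n))) =
     (\<Sum>w\<in>fib_words (Suc n). f (0 # w)) + (\<Sum>w\<in>fib_words n. f (1 # 0 # w))"
proof -
  have "sum f (fib_words (Suc (Suc n))) =
      sum f ((#) 0 ` fib_words (Suc n)) + sum f ((\<lambda>w. 1 # 0 # w) ` fib_words n)"
    unfolding fib_words_Suc_Suc
    by (rule sum.union_disjoint) (auto simp: finite_fib_words)
  also have "\<dots> = (\<Sum>w\<in>fib_words (Suc n). f (0 # w)) + (\<Sum>w\<in>fib_words n. f (1 # 0 # w))"
    by (simp add: sum.reindex inj_on_def)
  finally show ?thesis .
qed

lemma d4_eq_ones_pairs: "d4 n = (\<Sum>w\<in>fib_words n. monom 1 (ones_pairs w))"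
  unfolding d4_def by (intro sum.cong refl) (simp add: deg4_bargraph fib_words_def)

text \<open>The weight of a word after a prefix depends on the last letter of the prefix. Both
  prefixes, 0 and 10, end in 0, so keeping that 0 in the weight closes the recursion.\<close>

definition zero_led :: "nat \<Rightarrow> int poly" where
  "zero_led n = (\<Sum>w\<in>fib_words n. monom 1 (ones_pairs (0 # w)))"

lemma zero_led_0: "zero_led 0 = 1"
  by (simp add: zero_led_def fib_words_0)

lemma zero_led_1: "zero_led (Suc 0) = [:1, 1:]"
  by (simp add: zero_led_def fib_words_1 monom_Suc one_pCons)

text \<open>After the fixed 0, a further 0 adds no pair with a 1, while 10 adds the two pairs 01 and
  10.\<close>

lemma zero_led_Suc_Suc: "zero_led (Suc (Suc n)) = zero_led (Suc n) + monom 1 2 * zero_led n"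
  unfolding zero_led_def sum_fib_words_Suc_Suc
  by (simp add: sum_distrib_left mult_monom)

lemma d4_Suc_Suc: "d4 (Suc (Suc n)) = zero_led (Suc n) + monom 1 1 * zero_led n"
  unfolding zero_led_def d4_eq_ones_pairs sum_fib_words_Suc_Suc
  by (simp add: sum_distrib_left mult_monom)

lemma d4_1: "d4 (Suc 0) = [:2:]"
  by (simp add: d4_eq_ones_pairs fib_words_1 numeral_poly)

lemma d4_2: "d4 (Suc (Suc 0)) = [:1, 2:]"
  by (simp add: d4_Suc_Suc zero_led_0 zero_led_1 monom_Suc one_pCons)

lemma d4_rec: "d4 (n + 3) = d4 (n + 2) + monom 1 2 * d4 (n + 1)"
proof (cases n)
  \<comment> \<open>\<open>d4 1\<close> is out of reach of \<open>d4_Suc_Suc\<close>, so this case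
    is computed; in the other one all three terms expand linearly in
    \<open>zero_led\<close>.\<close>
  case 0
  then show ?thesis
    by (simp add: eval_nat_numeral d4_Suc_Suc d4_1 zero_led_Suc_Suc zero_led_0 zero_led_1
        monom_Suc one_pCons)
next
  case (Suc m)
  then show ?thesis
    by (simp add: eval_nat_numeral d4_Suc_Suc zero_led_Suc_Suc algebra_simps)
qed

section \<open>The closed formula\<close>

text \<open>The condition on \<open>b\<close> cannot be dropped: for \<open>a = 0\<close> and \<open>b = -1\<close> the right-hand side is 1.\<close>

lemma int_binom_Pascal:
  assumes "0 \<le> b"
  shows "int_binom a b = int_binom (a - 1) b + int_binom (a - 1) (b - 1)"
\<comment> \<open>Strictly inside the triangle this is the usual identity. On its border the
  convention decides: for \<open>a = b = 0\<close> the value 1 comes from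
  \<open>int_binom (- 1) (- 1)\<close>.\<close>
proof (cases "0 < b \<and> b < a")
  case True
  define m k where "m = nat (a - 1)" and "k = nat (b - 1)"
  have "a = int (Suc m)" "b = int (Suc k)"
    using True by (auto simp: m_def k_def)
  moreover have "k < m" using True by (auto simp: m_def k_def)
  ultimately show ?thesis
    by (cases "m = Suc k") (auto simp: int_binom_def nat_add_distrib)
next
  case False
  then show ?thesis using assms by (auto simp: int_binom_def)
qed

text \<open>The coefficient of \<open>q\<^sup>k\<close> in the closed formula, where \<open>k = i - 3\<close>.\<close>

definition d4_coeff :: "nat \<Rightarrow> nat \<Rightarrow> int" where
  "d4_coeff n k = int_binom (int n - 1 - (int k + 1) div 2) (int k div 2)
     + int_binom (int n - 2 - int k div 2) ((int k - 1) div 2)"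

text \<open>As \<open>(k + 1) div 2 + k div 2 = k\<close> and
  \<open>k div 2 + (k - 1) div 2 = k - 1\<close> over the integers, both lower arguments exceed the
  upper ones once \<open>k\<close> reaches \<open>n\<close>.\<close>

lemma d4_coeff_eq_0:
  assumes "n \<le> k"
  shows "d4_coeff n k = 0"
proof -
  have "int n - 1 - (int k + 1) div 2 < int k div 2"
       "int n - 2 - int k div 2 < (int k - 1) div 2"
    using assms by linarith+
  then show ?thesis by (simp add: d4_coeff_def int_binom_def)
qed

text \<open>Lowering \<open>k\<close> by 2 lowers each of the three halves by 1, so the claim is
  Pascal's rule for both binomials. For \<open>k < 2\<close> the coefficients are the constants 1
  and 2.\<close>

lemma d4_coeff_rec:
  "d4_coeff (n + 3) k = d4_coeff (n + 2) k + (if k < 2 then 0 else d4_coeff (n + 1) (k - 2))"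
proof (cases "k < 2")
  case True
  then consider "k = 0" | "k = 1" by linarith
  then show ?thesis
    by cases (simp_all add: d4_coeff_def int_binom_def)
next
  case False
  then obtain j where k: "k = j + 2" by (metis add.commute le_Suc_ex not_less)
  define a b c where "a = (int j + 1) div 2" and "b = int j div 2" and "c = (int j - 1) div 2"
  have dv: "(int k + 1) div 2 = a + 1" "int k div 2 = b + 1" "(int k - 1) div 2 = c + 1"
    unfolding k a_def b_def c_def by simp_all
  \<comment> \<open>For \<open>j = 0\<close> the value of \<open>c\<close> is -1, so
    \<open>c + 1\<close> just meets the hypothesis of Pascal's rule.\<close>
  have "0 \<le> b + 1" "0 \<le> c + 1" unfolding b_def c_def by simp_all
  from int_binom_Pascal[OF this(1), of "int n + 1 - a"] int_binom_Pascal[OF this(2), of "int n - b"]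
  show ?thesis
    using False unfolding d4_coeff_def dv
    by (simp add: k a_def b_def c_def algebra_simps)
qed

lemma coeff_d4: "coeff (d4 (Suc n)) k = d4_coeff (Suc n) k"
proof (induction n arbitrary: k rule: less_induct)
  case (less n)
  consider "n = 0" | "n = 1" | m where "n = Suc (Suc m)"
    by (metis One_nat_def not0_implies_Suc)
  then show ?case
  proof cases
    \<comment> \<open>The constant coefficient 2 is
      \<open>int_binom 0 0 + int_binom (- 1) (- 1)\<close>.\<close>
    case 1
    then show ?thesis
      by (cases k) (simp_all add: d4_1 d4_coeff_eq_0, simp add: d4_coeff_def int_binom_def)
  next
    case 2
    consider "k = 0" | "k = 1" | j where "k = Suc (Suc j)"
      by (metis One_nat_def not0_implies_Suc)
    then show ?thesis
      using 2 by cases (simp_all add: d4_2 d4_coeff_eq_0, simp_all add: d4_coeff_def int_binom_def)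
  next
    case (3 m)
    have "coeff (d4 (m + 3)) k = coeff (d4 (m + 2)) k + (if k < 2 then 0 else coeff (d4 (m + 1)) (k - 2))"
      unfolding d4_rec by (simp add: coeff_monom_mult)
    also have "\<dots> = d4_coeff (m + 3) k"
      unfolding d4_coeff_rec using less.IH[of "Suc m" k] less.IH[of m "k - 2"] 3 by simp
    finally show ?thesis using 3 by (simp add: eval_nat_numeral)
  qed
qed

lemma floor_half_diff: "\<lfloor>(real i - numeral m) / 2\<rfloor> = (int i - numeral m) div 2"
  using floor_divide_of_int_eq[of "int i - numeral m" 2, where ?'a = real] by simp

text \<open>The three terms with negative exponent vanish.\<close>

lemma int_binom_sum_shifted:
  assumes "n \<ge> 1"
  shows "int_binom (int n - 1 - \<lfloor>(real i - 2) / 2\<rfloor>) \<lfloor>(real i - 3) / 2\<rfloor>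
      + int_binom (int n - 2 - \<lfloor>(real i - 3) / 2\<rfloor>) \<lfloor>(real i - 4) / 2\<rfloor>
    = (if i < 3 then 0 else d4_coeff n (i - 3))"
proof (cases "i < 3")
  case True
  then consider "i = 0" | "i = 1" | "i = 2" by linarith
  then show ?thesis
    \<comment> \<open>The lower arguments are negative, while \<open>n \<ge> 1\<close> keeps the
      upper ones nonnegative, so the exceptional value 1 on the diagonal cannot occur.\<close>
    unfolding floor_half_diff using assms by cases (simp_all add: int_binom_def)
next
  case False
  then obtain k where "i = k + 3" by (metis add.commute le_Suc_ex not_less)
  then show ?thesis
    unfolding floor_half_diff by (simp add: d4_coeff_def algebra_simps)
qed

lemma fls_of_poly_eq_sum:
  assumes "\<And>k. n \<le> k \<Longrightarrow> coeff p k = 0"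
  shows "fls_of_poly p = (\<Sum>k<n. of_int (coeff p k) * fls_X_intpow (int k))"
proof (rule fls_eqI)
  fix j :: int
  have "fls_nth (\<Sum>k<n. of_int (coeff p k) * fls_X_intpow (int k)) j
      = (\<Sum>k<n. if j = int k then coeff p k else 0)"
    by (auto simp: fls_nth_sum fls_of_int intro!: sum.cong)
  also have "\<dots> = fls_nth (fls_of_poly p) j"
  proof (cases "j < 0")
    case True
    then show ?thesis by (simp add: fls_of_poly_def)
  next
    case False
    then have "j = int k \<longleftrightarrow> nat j = k" for k by auto
    then show ?thesis using False assms[of "nat j"]
      by (simp add: fls_of_poly_def)
  qed
  finally show "fls_nth (fls_of_poly p) j
      = fls_nth (\<Sum>k<n. of_int (coeff p k) * fls_X_intpow (int k)) j"
    by simp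
qed

lemma fls_of_poly_d4:
  assumes "n \<ge> 1"
  shows "fls_of_poly (d4 n) =
        (\<Sum>i = 0..n + 2.
          of_int (int_binom (int n - 1 - \<lfloor>(real i - 2) / 2\<rfloor>) \<lfloor>(real i - 3) / 2\<rfloor>
                + int_binom (int n - 2 - \<lfloor>(real i - 3) / 2\<rfloor>) \<lfloor>(real i - 4) / 2\<rfloor>)
          * fls_X_intpow (int i - 3))"
proof -
  have coeff: "coeff (d4 n) k = d4_coeff n k" for k
    using coeff_d4[of "n - 1" k] assms by simp
  let ?f = "\<lambda>i. of_int (if i < 3 then 0 else d4_coeff n (i - 3)) * fls_X_intpow (int i - 3) :: int fls"
  \<comment> \<open>Dropping the three zero terms leaves a range that shifts by 3 to the exponents
    below \<open>n\<close>.\<close>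
  have "(\<Sum>i = 0..n + 2. ?f i) = (\<Sum>i = 0 + 3..<n + 3. ?f i)"
    by (rule sum.mono_neutral_right) auto
  also have "\<dots> = (\<Sum>k<n. of_int (d4_coeff n k) * fls_X_intpow (int k))"
    unfolding sum.shift_bounds_nat_ivl by (simp add: lessThan_atLeast0)
  also have "\<dots> = fls_of_poly (d4 n)"
    using fls_of_poly_eq_sum[of n "d4 n"] by (simp add: coeff d4_coeff_eq_0)
  finally show ?thesis
    unfolding int_binom_sum_shifted[OF assms] by simp
qed

theorem theorem3p7:
  shows "(\<forall>n\<ge>3. d4 n = d4 (n - 1) + monom 1 2 * d4 (n - 2))
    \<and> d4 1 = [:2:]
    \<and> d4 2 = [:1, 2:]
    \<and> (\<forall>n\<ge>1. fls_of_poly (d4 n) =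
        (\<Sum>i = 0..n + 2.
          of_int (int_binom (int n - 1 - \<lfloor>(real i - 2) / 2\<rfloor>) \<lfloor>(real i - 3) / 2\<rfloor>
                + int_binom (int n - 2 - \<lfloor>(real i - 3) / 2\<rfloor>) \<lfloor>(real i - 4) / 2\<rfloor>)
          * fls_X_intpow (int i - 3)))"
proof (intro conjI allI impI)
  fix n :: nat assume "n \<ge> 3"
  then obtain m where "n = m + 3" by (metis add.commute le_Suc_ex)
  then show "d4 n = d4 (n - 1) + monom 1 2 * d4 (n - 2)"
    using d4_rec[of m] by (simp add: eval_nat_numeral)
next
  show "d4 1 = [:2:]" "d4 2 = [:1, 2:]"
    using d4_1 d4_2 by (simp_all add: eval_nat_numeral)
qed (rule fls_of_poly_d4)

end
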